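(* Let $(\tilde\lambda,\tilde v)$ be an approximate eigenpair of the problem $A(v)v=\lambda v$, let $r=A(\tilde v)\tilde v-\tilde\lambda\tilde v$ be the associated residual, and let $\vartheta$ be the angle between $r$ and $\tilde v$, i.e. $\vartheta:=\arccos\left((r^T\tilde v)/(\|r\|\|\tilde v\|)\right)$. Then $$\eta_{\mathrm{sym}}^{(2)}(\tilde\lambda,\tilde v)=\eta(\tilde\lambda,\tilde v)\quad\text{and}\quad \eta_{\mathrm{sym}}^{(F)}(\tilde\lambda,\tilde v)=\eta(\tilde\lambda,\tilde v)\,\gamma,$$ where $$\gamma:=\sqrt{1+\sin^2(\vartheta)}.$$
   Context: Setting. Let $A:\mathbb{R}^n\to\mathbb{R}^{n\times n}$ be of the form $A(v)=\sum_{i=1}^m f_i(v)A_i$, where each $A_i\in\mathbb{R}^{n\times n}$ is symmetric, each $f_i:\mathbb{R}^n\to\mathbb{R}$ is scaling invariant, i.e. $f_i(\alpha x)=f_i(x)$ for all $x\in\mathbb{R}^n$ and $\alpha\in\mathbb{R}\setminus\{0\}$, and $A$ is continuously differentiable on $\mathbb{R}^n\setminus\{0\}$. The eigenvalue problem is to find $(\lambda,v)\in\mathbb{R}\times(\mathbb{R}^n\setminus\{0\})$ with $A(v)v=\lambda v$. An approximate eigenpair is a pair $(\tilde\lambda,\tilde v)\in\mathbb{R}\times(\mathbb{R}^n\setminus\{0\})$ regarded as an approximation of such a solution. Definitions. Let $w_i\ge0$, $i=1,\dots,m$, be prescribed weights. The backward error of $(\tilde\lambda,\tilde v)$ is $$\eta(\tilde\lambda,\tilde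 v)=\min\left\{|\varepsilon|:\ \Big(A(\tilde v)+\varepsilon\sum_{i=1}^m f_i(\tilde v)E_i\Big)\tilde v=\tilde\lambda\tilde v,\ \|E_i\|\le w_i,\ i=1,\dots,m\right\},$$ where the minimum is taken over $\varepsilon\in\mathbb{R}$ and the matrices $E_1,\dots,E_m\in\mathbb{R}^{n\times n}$, and the matrix norm is either the spectral norm or the Frobenius norm. The symmetric backward error of $(\tilde\lambda,\tilde v)$ is $$\eta_{\mathrm{sym}}^{( * )}(\tilde\lambda,\tilde v)=\min\left\{|\varepsilon|:\ \Big(A(\tilde v)+\varepsilon\sum_{i=1}^m f_i(\tilde v)E_i\Big)\tilde v=\tilde\lambda\tilde v,\ \|E_i\|_*\le w_i,\ E_i^T=E_i,\ i=1,\dots,m\right\},$$ with the minimum again over $\varepsilon$ and the matrices $E_i$, where $*$ is either $2$ or $F$ for the spectral norm and the Frobenius norm, respectively. For vectors, $\|\cdot\|$ is the Euclidean norm. *)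

theory Defs
  imports "HOL-Analysis.Analysis"
begin

definition spectral_norm :: "real ^ 'n ^ 'n \<Rightarrow> real" where
  "spectral_norm E = onorm (\<lambda>x. E *v x)"

definition frobenius_norm :: "real ^ 'n ^ 'n \<Rightarrow> real" where
  "frobenius_norm E = sqrt (\<Sum>i\<in>UNIV. \<Sum>j\<in>UNIV. (E $ i $ j)\<^sup>2)"

definition symmetric_matrix :: "real ^ 'n ^ 'n \<Rightarrow> bool" where
  "symmetric_matrix E \<longleftrightarrow> transpose E = E"

text \<open>Intended for open sets; the derivative is the Frechet derivative, continuous with respect to
  the operator norm.\<close>

definition continuously_differentiable_on ::
    "('a::real_normed_vector \<Rightarrow> 'b::real_normed_vector) \<Rightarrow> 'a set \<Rightarrow> bool" where
  "continuously_differentiable_on F S \<longleftrightarrow>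
     (\<exists>F' :: 'a \<Rightarrow> 'a \<Rightarrow>\<^sub>L 'b.
        (\<forall>x\<in>S. (F has_derivative blinfun_apply (F' x)) (at x)) \<and> continuous_on S F')"

text \<open>
  The minimum of a set of reals, with the convention that the minimum of the empty set is
  \<open>\<infinity>\<close>. For nonempty sets without a least element the value is unspecified; by the lemmas
  \<open>backward_error_set_attains_min\<close> and \<open>sym_backward_error_set_attains_min\<close> below this case never
  occurs for the sets considered here.
\<close>

definition min_of :: "real set \<Rightarrow> ereal" where
  "min_of S = (if S = {} then \<infinity> else ereal (LEAST e. e \<in> S))"

text \<open>
  In the following, \<open>A\<close>, \<open>f\<close> and \<open>m\<close> are the data of \<open>A(v) = \<Sum>i=1..m. f\<^sub>i(v) A\<^sub>i\<close>, \<open>w\<close> are the weights,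
  and \<open>N\<close> is the matrix norm used to measure the perturbations.
\<close>

definition backward_error_set ::
    "(real ^ 'n ^ 'n \<Rightarrow> real) \<Rightarrow> nat \<Rightarrow> (nat \<Rightarrow> real ^ 'n \<Rightarrow> real) \<Rightarrow> (real ^ 'n \<Rightarrow> real ^ 'n ^ 'n)
      \<Rightarrow> (nat \<Rightarrow> real) \<Rightarrow> real \<Rightarrow> real ^ 'n \<Rightarrow> real set" where
  "backward_error_set N m f A w lam v =
     {\<bar>\<epsilon>\<bar> | \<epsilon> E.
        (A v + \<epsilon> *\<^sub>R (\<Sum>i=1..m. f i v *\<^sub>R E i)) *v v = lam *\<^sub>R v \<and>
        (\<forall>i\<in>{1..m}. N (E i) \<le> w i)}"

definition sym_backward_error_set ::
    "(real ^ 'n ^ 'n \<Rightarrow> real) \<Rightarrow> nat \<Rightarrow> (nat \<Rightarrow> real ^ 'n \<Rightarrow> real) \<Rightarrow> (real ^ 'n \<Rightarrow> real ^ 'n ^ 'n)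
      \<Rightarrow> (nat \<Rightarrow> real) \<Rightarrow> real \<Rightarrow> real ^ 'n \<Rightarrow> real set" where
  "sym_backward_error_set N m f A w lam v =
     {\<bar>\<epsilon>\<bar> | \<epsilon> E.
        (A v + \<epsilon> *\<^sub>R (\<Sum>i=1..m. f i v *\<^sub>R E i)) *v v = lam *\<^sub>R v \<and>
        (\<forall>i\<in>{1..m}. N (E i) \<le> w i \<and> symmetric_matrix (E i))}"

definition backward_error ::
    "(real ^ 'n ^ 'n \<Rightarrow> real) \<Rightarrow> nat \<Rightarrow> (nat \<Rightarrow> real ^ 'n \<Rightarrow> real) \<Rightarrow> (real ^ 'n \<Rightarrow> real ^ 'n ^ 'n)
      \<Rightarrow> (nat \<Rightarrow> real) \<Rightarrow> real \<Rightarrow> real ^ 'n \<Rightarrow> ereal" where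
  "backward_error N m f A w lam v = min_of (backward_error_set N m f A w lam v)"

definition sym_backward_error ::
    "(real ^ 'n ^ 'n \<Rightarrow> real) \<Rightarrow> nat \<Rightarrow> (nat \<Rightarrow> real ^ 'n \<Rightarrow> real) \<Rightarrow> (real ^ 'n \<Rightarrow> real ^ 'n ^ 'n)
      \<Rightarrow> (nat \<Rightarrow> real) \<Rightarrow> real \<Rightarrow> real ^ 'n \<Rightarrow> ereal" where
  "sym_backward_error N m f A w lam v = min_of (sym_backward_error_set N m f A w lam v)"


subsection \<open>The minima are attained\<close>

lemma frobenius_norm_eq_norm: "frobenius_norm E = norm E"
  by (simp add: frobenius_norm_def norm_vec_def L2_set_def sum_nonneg)

lemma compact_frobenius_ball: "compact {E :: real ^ 'n ^ 'n. frobenius_norm E \<le> c}"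
proof -
  have "{E :: real ^ 'n ^ 'n. frobenius_norm E \<le> c} = cball 0 c"
    by (auto simp: frobenius_norm_eq_norm)
  then show ?thesis by simp
qed

lemma compact_spectral_ball: "compact {E :: real ^ 'n ^ 'n. spectral_norm E \<le> c}"
proof -
  have iff: "spectral_norm E \<le> c \<longleftrightarrow> (\<forall>x. norm (E *v x) \<le> c * norm x)"
    for E :: "real ^ 'n ^ 'n"
  proof
    assume c: "spectral_norm E \<le> c"
    show "\<forall>x. norm (E *v x) \<le> c * norm x"
    proof
      fix x
      have "norm (E *v x) \<le> onorm ((*v) E) * norm x"
        by (rule onorm) (rule matrix_vector_mul_bounded_linear)
      also have "\<dots> \<le> c * norm x"
        using c by (intro mult_right_mono) (auto simp: spectral_norm_def)
      finally show "norm (E *v x) \<le> c * norm x" .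
    qed
  qed (auto simp: spectral_norm_def intro: onorm_le)
  have "bounded {E :: real ^ 'n ^ 'n. spectral_norm E \<le> c}"
  proof (rule boundedI)
    fix E :: "real ^ 'n ^ 'n" assume "E \<in> {E. spectral_norm E \<le> c}"
    then have le: "\<bar>E $ i $ j\<bar> \<le> c" for i j
      using matrix_component_le_onorm[of E i j] by (auto simp: spectral_norm_def)
    have "norm E \<le> (\<Sum>i\<in>UNIV. norm (E $ i))"
      unfolding norm_vec_def[of E] by (rule L2_set_le_sum) simp
    also have "\<dots> \<le> (\<Sum>i\<in>(UNIV :: 'n set). \<Sum>j\<in>(UNIV :: 'n set). c)"
      by (intro sum_mono order_trans[OF norm_le_l1_cart]) (use le in auto)
    finally show "norm E \<le> (\<Sum>i\<in>(UNIV :: 'n set). \<Sum>j\<in>(UNIV :: 'n set). c)" .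
  qed
  moreover have "closed {E :: real ^ 'n ^ 'n. spectral_norm E \<le> c}"
    unfolding iff
    by (intro closed_Collect_all closed_Collect_le continuous_intros
        linear_continuous_on linear_conv_bounded_linear[THEN iffD1])
      (auto intro!: linearI simp: matrix_vector_mult_add_rdistrib scaleR_matrix_vector_assoc)
  ultimately show ?thesis
    by (simp add: compact_eq_bounded_closed)
qed

lemma closed_symmetric_matrix: "closed {E :: real ^ 'n ^ 'n. symmetric_matrix E}"
proof -
  have "{E :: real ^ 'n ^ 'n. symmetric_matrix E} = {E. \<forall>i j. E $ j $ i = E $ i $ j}"
    by (auto simp: symmetric_matrix_def transpose_def vec_eq_iff)
  also have "closed \<dots>"
    by (intro closed_Collect_all closed_Collect_eq continuous_intros)
  finally show ?thesis .
qed

lemma compact_weighted_sums: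
  fixes K :: "nat \<Rightarrow> 'a::real_normed_vector set"
  assumes "\<And>i. compact (K i)"
  shows "compact {\<Sum>i=1..m. c i *\<^sub>R E i | E. \<forall>i\<in>{1..m}. E i \<in> K i}"
proof (induction m)
  case 0
  then show ?case by simp
next
  case (Suc m)
  let ?T = "\<lambda>m. {\<Sum>i=1..m. c i *\<^sub>R E i | E. \<forall>i\<in>{1..m}. E i \<in> K i}"
  have "?T (Suc m) = {x + y | x y. x \<in> ?T m \<and> y \<in> (\<lambda>z. c (Suc m) *\<^sub>R z) ` K (Suc m)}"
    (is "_ = ?R")
  proof (intro equalityI subsetI)
    fix x assume "x \<in> ?T (Suc m)"
    then obtain E where "x = (\<Sum>i=1..Suc m. c i *\<^sub>R E i)" "\<forall>i\<in>{1..Suc m}. E i \<in> K i" by auto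
    then have "x = (\<Sum>i=1..m. c i *\<^sub>R E i) + c (Suc m) *\<^sub>R E (Suc m)"
      "\<forall>i\<in>{1..m}. E i \<in> K i" "E (Suc m) \<in> K (Suc m)" by auto
    then show "x \<in> ?R" by blast
  next
    fix x assume "x \<in> ?R"
    then obtain E z where E: "x = (\<Sum>i=1..m. c i *\<^sub>R E i) + c (Suc m) *\<^sub>R z"
      "\<forall>i\<in>{1..m}. E i \<in> K i" "z \<in> K (Suc m)" by auto
    have "(\<Sum>i=1..m. c i *\<^sub>R (E(Suc m := z)) i) = (\<Sum>i=1..m. c i *\<^sub>R E i)"
      by (intro sum.cong) auto
    then have "x = (\<Sum>i=1..Suc m. c i *\<^sub>R (E(Suc m := z)) i)" using E by simp
    moreover have "\<forall>i\<in>{1..Suc m}. (E(Suc m := z)) i \<in> K i" using E by auto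
    ultimately show "x \<in> ?T (Suc m)" by blast
  qed
  moreover have "compact ?R"
    by (intro compact_sums Suc.IH compact_scaling assms)
  ultimately show ?case by simp
qed

lemma perturbation_set_attains_min:
  fixes K :: "nat \<Rightarrow> (real ^ 'n ^ 'n) set" and B :: "real ^ 'n ^ 'n" and v :: "real ^ 'n"
  assumes K: "\<And>i. compact (K i)"
    and S_def: "S = {\<bar>\<epsilon>\<bar> | \<epsilon> E. (B + \<epsilon> *\<^sub>R (\<Sum>i=1..m. c i *\<^sub>R E i)) *v v = lam *\<^sub>R v \<and>
          (\<forall>i\<in>{1..m}. E i \<in> K i)}"
    and "S \<noteq> {}"
  shows "\<exists>e\<in>S. \<forall>e'\<in>S. e \<le> e'"
proof -
  define T where "T = {\<Sum>i=1..m. c i *\<^sub>R E i | E. \<forall>i\<in>{1..m}. E i \<in> K i}"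
  have S: "S = {\<bar>\<epsilon>\<bar> | \<epsilon> X. (B + \<epsilon> *\<^sub>R X) *v v = lam *\<^sub>R v \<and> X \<in> T}"
    unfolding S_def T_def by blast
  obtain b where b: "b \<in> S" using assms(3) by blast
  define Z where "Z = ({-b..b} \<times> T) \<inter> {p. (B + fst p *\<^sub>R snd p) *v v = lam *\<^sub>R v}"
  have lin: "bounded_linear (\<lambda>X :: real ^ 'n ^ 'n. X *v v)"
    by (subst linear_conv_bounded_linear[symmetric])
      (auto intro!: linearI simp: matrix_vector_mult_add_rdistrib scaleR_matrix_vector_assoc)
  obtain \<epsilon> X where "b = \<bar>\<epsilon>\<bar>" "(B + \<epsilon> *\<^sub>R X) *v v = lam *\<^sub>R v" "X \<in> T"
    using b unfolding S by blast
  then have "(\<epsilon>, X) \<in> Z"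
    unfolding Z_def by auto
  then have "Z \<noteq> {}" by blast
  moreover have "compact Z"
    unfolding Z_def T_def
    by (intro compact_Int_closed compact_Times compact_weighted_sums K compact_Icc
        closed_Collect_eq continuous_intros bounded_linear.continuous_on[OF lin])
  moreover have continuous_on_Z: "continuous_on Z (\<lambda>p. \<bar>fst p\<bar>)"
    by (intro continuous_intros)
  ultimately obtain p where p: "p \<in> Z" and le: "\<forall>q\<in>Z. \<bar>fst p\<bar> \<le> \<bar>fst q\<bar>"
    using continuous_attains_inf[of Z "\<lambda>p. \<bar>fst p\<bar>"] continuous_on_Z by blast
  have "(B + fst p *\<^sub>R snd p) *v v = lam *\<^sub>R v" "snd p \<in> T"
    using p unfolding Z_def by auto
  then have "\<bar>fst p\<bar> \<in> S" unfolding S by blast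
  moreover have "\<bar>fst p\<bar> \<le> e'" if "e' \<in> S" for e'
  proof (cases "e' \<le> b")
    case True
    from that obtain \<epsilon>' X' where e': "e' = \<bar>\<epsilon>'\<bar>" "(B + \<epsilon>' *\<^sub>R X') *v v = lam *\<^sub>R v" "X' \<in> T"
      unfolding S by blast
    with True have "(\<epsilon>', X') \<in> Z"
      unfolding Z_def by auto
    with le have "\<bar>fst p\<bar> \<le> \<bar>fst (\<epsilon>', X')\<bar>" by blast
    with e'(1) show ?thesis by simp
  next
    case False
    moreover have "\<bar>fst p\<bar> \<le> b" using p unfolding Z_def by auto
    ultimately show ?thesis by linarith
  qed
  ultimately show ?thesis by blast
qed

lemma backward_error_set_attains_min:
  assumes "N = spectral_norm \<or> N = frobenius_norm" "backward_error_set N m f A w lam v \<noteq> {}"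
  shows "\<exists>e \<in> backward_error_set N m f A w lam v. \<forall>e' \<in> backward_error_set N m f A w lam v. e \<le> e'"
proof (rule perturbation_set_attains_min)
  show "compact {E. N E \<le> w i}" for i
    using assms(1) compact_spectral_ball compact_frobenius_ball by auto
qed (use assms(2) in \<open>auto simp: backward_error_set_def\<close>)

lemma sym_backward_error_set_attains_min:
  assumes "N = spectral_norm \<or> N = frobenius_norm" "sym_backward_error_set N m f A w lam v \<noteq> {}"
  shows "\<exists>e \<in> sym_backward_error_set N m f A w lam v.
    \<forall>e' \<in> sym_backward_error_set N m f A w lam v. e \<le> e'"
proof (rule perturbation_set_attains_min)
  show "compact ({E. N E \<le> w i} \<inter> {E. symmetric_matrix E})" for i
    using assms(1) compact_spectral_ball compact_frobenius_ball
    by (intro compact_Int_closed closed_symmetric_matrix) auto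
qed (use assms(2) in \<open>auto simp: sym_backward_error_set_def\<close>)

end

theory Submission
  imports Defs
begin

text \<open>
  Everything reduces to one minimal-norm problem: among the admissible matrices \<open>X\<close> with \<open>X v = -r\<close>,
  find the least value \<open>c\<close> of \<open>N X\<close>. The matrices \<open>\<epsilon> \<Sum> f\<^sub>i(v) E\<^sub>i\<close> have norm at most
  \<open>\<bar>\<epsilon>\<bar> s\<close> with \<open>s = \<Sum> \<bar>f\<^sub>i(v)\<bar> w\<^sub>i\<close>, and choosing all \<open>E\<^sub>i\<close> proportional to a
  minimizer \<open>X\<close> attains this, so the backward error is \<open>c / s\<close>. Without symmetry
  \<open>c = \<parallel>r\<parallel> / \<parallel>v\<parallel>\<close>, attained by a rank-one matrix. For symmetric matrices and the spectral norm the same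
  value is attained by a multiple of the Householder reflection exchanging the directions of \<open>v\<close> and
  \<open>-r\<close>. For symmetric matrices and the Frobenius norm the minimizer is the orthogonal projection of
  any symmetric solution onto the span of the symmetrized dyads containing \<open>v\<close>, of norm
  \<open>\<gamma> \<parallel>r\<parallel> / \<parallel>v\<parallel>\<close>.
\<close>

section \<open>Dyads and symmetric matrices\<close>

definition outer :: "real ^ 'n \<Rightarrow> real ^ 'n \<Rightarrow> real ^ 'n ^ 'n" where
  "outer a b = (\<chi> i j. a $ i * b $ j)"

lemma outer_mult_vector: "outer a b *v x = (b \<bullet> x) *\<^sub>R a"
  by (simp add: outer_def matrix_vector_mult_def inner_vec_def vec_eq_iff sum_distrib_right
      sum_distrib_left algebra_simps)

lemma transpose_outer: "transpose (outer a b) = outer b a"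
  by (simp add: outer_def transpose_def vec_eq_iff mult.commute)

text \<open>The inner product of the nested vector type is the Frobenius one, so norms and angles
  involving dyads reduce to matrix-vector products.\<close>

lemma inner_outer_right: "X \<bullet> outer a b = (X *v b) \<bullet> a"
  by (simp add: outer_def matrix_vector_mult_def inner_vec_def sum_distrib_right
      sum_distrib_left algebra_simps)

lemma symmetric_matrix_add:
  "symmetric_matrix X \<Longrightarrow> symmetric_matrix Y \<Longrightarrow> symmetric_matrix (X + Y)"
  by (simp add: symmetric_matrix_def transpose_def vec_eq_iff)

lemma symmetric_matrix_scaleR: "symmetric_matrix X \<Longrightarrow> symmetric_matrix (a *\<^sub>R X)"
  by (simp add: symmetric_matrix_def transpose_def vec_eq_iff)

lemma symmetric_matrix_mult_inner:
  assumes "symmetric_matrix X"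
  shows "(X *v a) \<bullet> b = a \<bullet> (X *v b)"
  using assms by (metis dot_lmul_matrix inner_commute symmetric_matrix_def vector_transpose_matrix)

section \<open>The two matrix norms\<close>

text \<open>Cauchy-Schwarz for \<open>X\<close> against the dyad of \<open>X *v x\<close> and
  \<open>x\<close>, then cancellation of \<open>norm (X *v x)\<close>.\<close>

lemma norm_matrix_vector_mult_le_frobenius:
  fixes X :: "real ^ 'n ^ 'n"
  shows "norm (X *v x) \<le> frobenius_norm X * norm x"
proof -
  have "outer a b \<bullet> outer a b = (norm a * norm b)\<^sup>2" for a b :: "real ^ 'n"
    by (simp add: inner_outer_right outer_mult_vector power_mult_distrib power2_norm_eq_inner)
  then have "norm (outer (X *v x) x) = norm (X *v x) * norm x"
    by (simp add: norm_eq_sqrt_inner[of "outer _ _"] real_sqrt_abs)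
  then have "norm (X *v x) * norm (X *v x) \<le> (norm X * norm x) * norm (X *v x)"
    using norm_cauchy_schwarz[of X "outer (X *v x) x"]
    by (simp add: inner_outer_right norm_eq_sqrt_inner[of "X *v x"] algebra_simps)
  then show ?thesis
    by (cases "X *v x = 0") (auto simp: frobenius_norm_eq_norm)
qed

lemma norm_matrix_vector_mult_le_spectral: "norm (X *v x) \<le> spectral_norm X * norm x"
  unfolding spectral_norm_def by (rule onorm) (rule matrix_vector_mul_bounded_linear)

lemma spectral_norm_le_frobenius_norm: "spectral_norm X \<le> frobenius_norm X"
  unfolding spectral_norm_def by (rule onorm_le) (rule norm_matrix_vector_mult_le_frobenius)

text \<open>Collects the properties through which the reduction treats both norms at once.\<close>

definition matrix_seminorm :: "(real ^ 'n ^ 'n \<Rightarrow> real) \<Rightarrow> bool" where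
  "matrix_seminorm N \<longleftrightarrow>
     (\<forall>a X. N (a *\<^sub>R X) = \<bar>a\<bar> * N X) \<and> (\<forall>X Y. N (X + Y) \<le> N X + N Y)"

lemma matrix_seminormD:
  assumes "matrix_seminorm N"
  shows "N (a *\<^sub>R X) = \<bar>a\<bar> * N X" "N (X + Y) \<le> N X + N Y" "N 0 = 0"
proof -
  show scale: "N (a *\<^sub>R X) = \<bar>a\<bar> * N X" for a X
    using assms by (simp add: matrix_seminorm_def)
  show "N (X + Y) \<le> N X + N Y"
    using assms unfolding matrix_seminorm_def by blast
  show "N 0 = 0" using scale[of 0 0] by simp
qed

lemma matrix_seminorm_spectral: "matrix_seminorm spectral_norm"
  unfolding matrix_seminorm_def spectral_norm_def
proof (intro conjI allI)
  fix a and X Y :: "real ^ 'n ^ 'n"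
  show "onorm ((*v) (a *\<^sub>R X)) = \<bar>a\<bar> * onorm ((*v) X)"
    using onorm_scaleR[OF matrix_vector_mul_bounded_linear, of a X]
    by (simp only: scaleR_matrix_vector_assoc)
  show "onorm ((*v) (X + Y)) \<le> onorm ((*v) X) + onorm ((*v) Y)"
    using onorm_triangle[OF matrix_vector_mul_bounded_linear matrix_vector_mul_bounded_linear, of X Y]
    by (simp only: matrix_vector_mult_add_rdistrib[symmetric])
qed

lemma matrix_seminorm_frobenius: "matrix_seminorm frobenius_norm"
  by (simp add: matrix_seminorm_def frobenius_norm_eq_norm norm_triangle_ineq)

lemma matrix_seminorm_sum_le:
  assumes "matrix_seminorm N" "finite I"
  shows "N (\<Sum>i\<in>I. c i *\<^sub>R E i) \<le> (\<Sum>i\<in>I. \<bar>c i\<bar> * N (E i))"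
  using assms(2)
proof (induction I rule: finite_induct)
  case empty
  show ?case using matrix_seminormD(3)[OF assms(1)] by simp
next
  case (insert j I)
  have "N (c j *\<^sub>R E j + (\<Sum>i\<in>I. c i *\<^sub>R E i)) \<le> N (c j *\<^sub>R E j) + N (\<Sum>i\<in>I. c i *\<^sub>R E i)"
    by (rule matrix_seminormD(2)[OF assms(1)])
  also have "N (c j *\<^sub>R E j) = \<bar>c j\<bar> * N (E j)"
    by (rule matrix_seminormD(1)[OF assms(1)])
  finally show ?case using insert by simp
qed

section \<open>Reduction to a minimal-norm problem\<close>

lemma min_of_eqI:
  assumes "e \<in> S" "\<And>e'. e' \<in> S \<Longrightarrow> e \<le> e'"
  shows "min_of S = ereal e"
proof -
  have "(LEAST e. e \<in> S) = e" using assms by (intro Least_equality) auto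
  then show ?thesis using assms(1) by (auto simp: min_of_def)
qed

text \<open>
  The quotient is taken in \<^typ>\<open>ereal\<close>, where \<open>0 / 0 = 0\<close> and \<open>c / 0 = \<infinity>\<close> for \<open>c > 0\<close>: exactly the
  values for a vanishing and a nonvanishing residual when all \<open>f\<^sub>i(v) w\<^sub>i\<close> are zero.
\<close>

lemma min_of_perturbation_set:
  fixes B :: "real ^ 'n ^ 'n" and v :: "real ^ 'n" and c w :: "nat \<Rightarrow> real"
  assumes N: "matrix_seminorm N"
    and w: "\<And>i. i \<in> {1..m} \<Longrightarrow> w i \<ge> 0"
    and Q_add: "\<And>X Y. Q X \<Longrightarrow> Q Y \<Longrightarrow> Q (X + Y)"
    and Q_scale: "\<And>a X. Q X \<Longrightarrow> Q (a *\<^sub>R X)"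
    and lower: "\<And>X. Q X \<Longrightarrow> X *v v = - (B *v v - lam *\<^sub>R v) \<Longrightarrow> d \<le> N X"
    and X: "Q X" "X *v v = - (B *v v - lam *\<^sub>R v)" "N X \<le> d"
    and d: "d \<ge> 0" "d = 0 \<Longrightarrow> B *v v = lam *\<^sub>R v"
  shows "min_of {\<bar>\<epsilon>\<bar> | \<epsilon> E. (B + \<epsilon> *\<^sub>R (\<Sum>i=1..m. c i *\<^sub>R E i)) *v v = lam *\<^sub>R v \<and>
      (\<forall>i\<in>{1..m}. N (E i) \<le> w i \<and> Q (E i))} = ereal d / ereal (\<Sum>i=1..m. \<bar>c i\<bar> * w i)"
    (is "min_of ?S = ereal d / ereal ?s")
proof -
  have Q0: "Q 0" using Q_scale[OF X(1), of 0] by simp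
  note N0 = matrix_seminormD(3)[OF N]
  have Q_sum: "Q (\<Sum>i\<in>I. c i *\<^sub>R E i)" if "finite I" "\<forall>i\<in>I. Q (E i)" for I :: "nat set" and E
    using that by (induction I rule: finite_induct) (auto intro: Q0 Q_add Q_scale)
  have s0: "?s \<ge> 0" using w by (intro sum_nonneg mult_nonneg_nonneg) auto
  have le: "d \<le> e * ?s" if "e \<in> ?S" for e
  proof -
    from that obtain \<epsilon> E where e: "e = \<bar>\<epsilon>\<bar>"
      and eq: "(B + \<epsilon> *\<^sub>R (\<Sum>i=1..m. c i *\<^sub>R E i)) *v v = lam *\<^sub>R v"
      and E: "\<forall>i\<in>{1..m}. N (E i) \<le> w i \<and> Q (E i)" by blast
    let ?Y = "\<Sum>i=1..m. c i *\<^sub>R E i"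
    have "(\<epsilon> *\<^sub>R ?Y) *v v = - (B *v v - lam *\<^sub>R v)"
      using eq by (simp add: matrix_vector_mult_add_rdistrib algebra_simps eq_diff_eq)
    then have "d \<le> N (\<epsilon> *\<^sub>R ?Y)"
      using E by (intro lower Q_scale Q_sum) auto
    also have "\<dots> = \<bar>\<epsilon>\<bar> * N ?Y" by (rule matrix_seminormD(1)[OF N])
    also have "\<dots> \<le> \<bar>\<epsilon>\<bar> * (\<Sum>i=1..m. \<bar>c i\<bar> * N (E i))"
      by (intro mult_left_mono matrix_seminorm_sum_le N) auto
    also have "\<dots> \<le> \<bar>\<epsilon>\<bar> * ?s"
      using E by (intro mult_left_mono sum_mono) auto
    finally show ?thesis by (simp add: e)
  qed
  consider "d = 0" | "d > 0" "?s = 0" | "d > 0" "?s > 0" using d(1) s0 by linarith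
  then show ?thesis
  proof cases
    case 1
    have "0 \<in> ?S"
      using d(2)[OF 1] w Q0 N0 by (intro CollectI exI[of _ 0] exI[of _ "\<lambda>_. 0"]) auto
    then have "min_of ?S = ereal 0" by (rule min_of_eqI) auto
    then show ?thesis using 1 by (simp flip: zero_ereal_def)
  next
    case 2
    \<comment> \<open>With \<open>?s = 0\<close> the bound \<open>le\<close> would force
      \<open>d \<le> 0\<close>; no perturbation is feasible and both sides are infinite.\<close>
    then have "?S = {}" using le by fastforce
    then show ?thesis using 2 by (simp only: min_of_def) (simp add: divide_ereal_def)
  next
    case 3
    \<comment> \<open>The sign turns each \<open>c i\<close> into its absolute value, so no terms
      cancel; since \<open>N X = d\<close>, dividing by \<open>d\<close> uses up the weight
      \<open>w i\<close> wherever \<open>c i\<close> is nonzero.\<close>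
    define E where "E i = (sgn (c i) * w i / d) *\<^sub>R X" for i
    have "(\<Sum>i=1..m. c i *\<^sub>R E i) = (\<Sum>i=1..m. \<bar>c i\<bar> * w i / d) *\<^sub>R X"
      unfolding E_def scaleR_sum_left
      by (intro sum.cong refl) (simp add: abs_sgn mult.assoc)
    then have sum_E: "(\<Sum>i=1..m. c i *\<^sub>R E i) = (?s / d) *\<^sub>R X"
      by (simp add: sum_divide_distrib)
    have "N (E i) \<le> w i \<and> Q (E i)" if "i \<in> {1..m}" for i
    proof -
      have "N (E i) = \<bar>sgn (c i)\<bar> * (w i / d) * N X"
        using w[OF that] 3 by (simp add: E_def matrix_seminormD(1)[OF N] abs_mult)
      \<comment> \<open>Here \<open>lower\<close> is used to see that \<open>N X\<close> is
        nonnegative.\<close>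
      also have "\<dots> \<le> 1 * (w i / d) * d"
        using w[OF that] 3 X(3) lower[OF X(1,2)]
        by (intro mult_mono mult_right_mono mult_nonneg_nonneg) (auto simp: abs_sgn_eq)
      finally show ?thesis using 3 X(1) by (simp add: E_def Q_scale)
    qed
    moreover have "(d / ?s) *\<^sub>R (\<Sum>i=1..m. c i *\<^sub>R E i) = X"
      using 3 unfolding sum_E by simp
    then have "(B + (d / ?s) *\<^sub>R (\<Sum>i=1..m. c i *\<^sub>R E i)) *v v = lam *\<^sub>R v"
      using X(2) by (simp add: matrix_vector_mult_add_rdistrib)
    ultimately have "\<bar>d / ?s\<bar> \<in> ?S" by blast
    then have "d / ?s \<in> ?S" using 3 by simp
    moreover have "d / ?s \<le> e" if "e \<in> ?S" for e
      using le[OF that] 3 by (simp add: divide_simps mult.commute)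
    ultimately have "min_of ?S = ereal (d / ?s)" by (rule min_of_eqI)
    then show ?thesis using 3 by simp
  qed
qed

section \<open>Minimal-norm solutions of \<open>X *v v = y\<close>\<close>

text \<open>The Frobenius bound also bounds the spectral norm, so one dyad serves both
  norms.\<close>

lemma exists_norm_minimal_matrix:
  fixes v y :: "real ^ 'n"
  assumes "v \<noteq> 0"
  shows "\<exists>X. X *v v = y \<and> frobenius_norm X \<le> norm y / norm v"
proof (intro exI conjI)
  let ?X = "outer ((1 / (v \<bullet> v)) *\<^sub>R y) v"
  show "?X *v v = y" using assms by (simp add: outer_mult_vector)
  have "?X \<bullet> ?X = (norm y / norm v)\<^sup>2"
    using assms
    by (simp add: inner_outer_right outer_mult_vector power_divide power2_norm_eq_inner)
  then show "frobenius_norm ?X \<le> norm y / norm v"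
    by (simp add: frobenius_norm_eq_norm norm_eq_sqrt_inner[of ?X])
qed

lemma exists_symmetric_spectral_minimal_matrix:
  fixes v y :: "real ^ 'n"
  assumes "v \<noteq> 0"
  shows "\<exists>X. symmetric_matrix X \<and> X *v v = y \<and> spectral_norm X \<le> norm y / norm v"
proof -
  define k where "k = norm y / norm v"
  define u where "u = k *\<^sub>R v - y"
  \<comment> \<open>Reflection in the hyperplane orthogonal to \<open>u\<close>. If
    \<open>u = 0\<close>, division by zero makes \<open>H\<close> the identity, as desired since
    then \<open>k *\<^sub>R v = y\<close>.\<close>
  define H where "H = mat 1 - (2 / (u \<bullet> u)) *\<^sub>R outer u u"
  have H: "H *v x = x - (2 * (u \<bullet> x) / (u \<bullet> u)) *\<^sub>R u" for x
    by (simp add: H_def matrix_vector_mult_diff_rdistrib outer_mult_vector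
        flip: scaleR_matrix_vector_assoc)
  have norm_H: "norm (H *v x) = norm x" for x
    by (cases "u = 0")
      (simp_all add: H norm_eq_sqrt_inner inner_diff_left inner_diff_right inner_commute
        power2_eq_square field_simps)
  have kv: "(k *\<^sub>R v) \<bullet> (k *\<^sub>R v) = y \<bullet> y"
    using assms by (simp add: k_def power_divide flip: power2_norm_eq_inner)
  \<comment> \<open>Equality of the lengths of \<open>k *\<^sub>R v\<close> and \<open>y\<close>
    makes the reflection move the one exactly to the other.\<close>
  have "2 * (u \<bullet> (k *\<^sub>R v)) = u \<bullet> u"
    using kv by (simp add: u_def inner_diff_left inner_diff_right inner_commute algebra_simps)
  then have "H *v (k *\<^sub>R v) = y"
    by (cases "u = 0") (simp_all add: H u_def)
  then have "(k *\<^sub>R H) *v v = y"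
    by (simp add: matrix_vector_mult_scaleR scaleR_matrix_vector_assoc)
  moreover have "transpose (mat 1 :: real ^ 'n ^ 'n) = mat 1" by simp
  then have "symmetric_matrix H"
    using transpose_outer[of u u] by (simp add: H_def symmetric_matrix_def transpose_def vec_eq_iff)
  then have "symmetric_matrix (k *\<^sub>R H)" by (rule symmetric_matrix_scaleR)
  moreover have "spectral_norm (k *\<^sub>R H) \<le> k"
    unfolding spectral_norm_def
    by (rule onorm_le) (simp add: k_def norm_H flip: scaleR_matrix_vector_assoc)
  ultimately show ?thesis unfolding k_def by blast
qed

text \<open>Pairing a symmetric \<open>X\<close> with \<open>X0\<close> involves only
  \<open>X *v v\<close>, hence gives the same value for all symmetric solutions, \<open>X0\<close>
  included. The last dyad in \<open>X0\<close> cancels the multiple of \<open>v\<close> that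
  \<open>outer v y\<close> adds to \<open>X0 *v v\<close>.\<close>

lemma symmetric_frobenius_minimal_matrix:
  fixes v y :: "real ^ 'n"
  assumes "v \<noteq> 0"
  defines "X0 \<equiv> (1 / (v \<bullet> v)) *\<^sub>R (outer y v + outer v y)
      + (- (v \<bullet> y) / (v \<bullet> v)\<^sup>2) *\<^sub>R outer v v"
  shows "symmetric_matrix X0" "X0 *v v = y"
    and "(frobenius_norm X0)\<^sup>2 = 2 * (y \<bullet> y) / (v \<bullet> v) - (v \<bullet> y)\<^sup>2 / (v \<bullet> v)\<^sup>2"
    and "\<And>X. symmetric_matrix X \<Longrightarrow> X *v v = y \<Longrightarrow> frobenius_norm X0 \<le> frobenius_norm X"
proof -
  show sym: "symmetric_matrix X0"
    by (simp add: X0_def symmetric_matrix_def transpose_def outer_def vec_eq_iff mult.commute)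
  show X0v: "X0 *v v = y"
    using assms(1)
    by (simp only: X0_def matrix_vector_mult_add_rdistrib outer_mult_vector
        scaleR_matrix_vector_assoc[symmetric])
      (simp add: power2_eq_square inner_commute scaleR_add_right)
  have inner_X0: "X \<bullet> X0 = 2 * (y \<bullet> y) / (v \<bullet> v) - (v \<bullet> y)\<^sup>2 / (v \<bullet> v)\<^sup>2"
    if "symmetric_matrix X" "X *v v = y" for X
    using that symmetric_matrix_mult_inner[OF that(1), of y v]
    by (simp add: X0_def inner_add_right inner_diff_right inner_outer_right inner_commute power2_eq_square)
  show X0_sq: "(frobenius_norm X0)\<^sup>2 = 2 * (y \<bullet> y) / (v \<bullet> v) - (v \<bullet> y)\<^sup>2 / (v \<bullet> v)\<^sup>2"
    using inner_X0[OF sym X0v] by (simp add: frobenius_norm_eq_norm power2_norm_eq_inner)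
  show "frobenius_norm X0 \<le> frobenius_norm X" if "symmetric_matrix X" "X *v v = y" for X
  proof -
    \<comment> \<open>The difference \<open>X - X0\<close> is orthogonal to \<open>X0\<close>, so
      the right side of Cauchy-Schwarz bounds \<open>norm X0\<close> squared.\<close>
    have "norm X0 * norm X0 \<le> norm X * norm X0"
      using norm_cauchy_schwarz[of X X0] inner_X0[OF that] X0_sq
      by (simp add: frobenius_norm_eq_norm power2_eq_square)
    then show ?thesis
      by (cases "X0 = 0") (auto simp: frobenius_norm_eq_norm)
  qed
qed

section \<open>Evaluation of the backward errors\<close>

theorem theorem4p4:
  fixes m :: nat
    and f :: "nat \<Rightarrow> real ^ 'n \<Rightarrow> real"
    and As :: "nat \<Rightarrow> real ^ 'n ^ 'n"
    and A :: "real ^ 'n \<Rightarrow> real ^ 'n ^ 'n"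
    and w :: "nat \<Rightarrow> real"
    and lam :: real
    and v r :: "real ^ 'n"
    and \<theta> \<gamma> :: real
    and N :: "real ^ 'n ^ 'n \<Rightarrow> real"
  assumes "\<And>x. A x = (\<Sum>i=1..m. f i x *\<^sub>R As i)"
    and "\<And>i. i \<in> {1..m} \<Longrightarrow> symmetric_matrix (As i)"
    and "\<And>i x \<alpha>. i \<in> {1..m} \<Longrightarrow> \<alpha> \<noteq> 0 \<Longrightarrow> f i (\<alpha> *\<^sub>R x) = f i x"
    and "continuously_differentiable_on A (UNIV - {0})"
    and "\<And>i. i \<in> {1..m} \<Longrightarrow> w i \<ge> 0"
    and "v \<noteq> 0"
    and "r = A v *v v - lam *\<^sub>R v"
    and "\<theta> = arccos ((r \<bullet> v) / (norm r * norm v))"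
    and "\<gamma> = sqrt (1 + (sin \<theta>)\<^sup>2)"
    and "N = spectral_norm \<or> N = frobenius_norm"
  shows "sym_backward_error spectral_norm m f A w lam v = backward_error N m f A w lam v
    \<and> sym_backward_error frobenius_norm m f A w lam v = backward_error N m f A w lam v * ereal \<gamma>"
proof -
  note w = assms(5) and v = assms(6)
  let ?d = "norm r / norm v" and ?s = "\<Sum>i=1..m. \<bar>f i v\<bar> * w i"
  have d: "?d \<ge> 0" "?d = 0 \<Longrightarrow> A v *v v = lam *\<^sub>R v"
    using v assms(7) by auto
  have lower: "?d \<le> M X" if "X *v v = - (A v *v v - lam *\<^sub>R v)"
      "M = spectral_norm \<or> M = frobenius_norm" for X M
  proof -
    have "norm r \<le> M X * norm v"
      using norm_matrix_vector_mult_le_spectral[of X v] norm_matrix_vector_mult_le_frobenius[of X v]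
        that assms(7) by (auto simp: norm_minus_commute)
    then show ?thesis using v by (simp add: divide_simps)
  qed
  have N: "matrix_seminorm N"
    using assms(10) matrix_seminorm_spectral matrix_seminorm_frobenius by blast
  have unstructured: "backward_error N m f A w lam v = ereal ?d / ereal ?s"
  proof -
    obtain X where X: "X *v v = - (A v *v v - lam *\<^sub>R v)" "frobenius_norm X \<le> norm (- r) / norm v"
      using exists_norm_minimal_matrix[OF v] assms(7) by metis
    have "N X \<le> ?d"
      using assms(10) X(2) spectral_norm_le_frobenius_norm[of X] by auto
    \<comment> \<open>The unstructured problem is the instance whose admissibility predicate is
      constantly true.\<close>
    then have "min_of {\<bar>\<epsilon>\<bar> | \<epsilon> E. (A v + \<epsilon> *\<^sub>R (\<Sum>i=1..m. f i v *\<^sub>R E i)) *v v = lam *\<^sub>R v \<and>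
        (\<forall>i\<in>{1..m}. N (E i) \<le> w i \<and> True)} = ereal ?d / ereal ?s"
      by (intro min_of_perturbation_set[where X = X] N w d lower X(1) assms(10) TrueI)
    then show ?thesis by (simp add: backward_error_def backward_error_set_def)
  qed
  have "sym_backward_error spectral_norm m f A w lam v = ereal ?d / ereal ?s"
  proof -
    obtain X where X: "symmetric_matrix X" "X *v v = - (A v *v v - lam *\<^sub>R v)"
        "spectral_norm X \<le> norm (- r) / norm v"
      using exists_symmetric_spectral_minimal_matrix[OF v] assms(7) by metis
    then have "spectral_norm X \<le> ?d" by simp
    then show ?thesis
      unfolding sym_backward_error_def sym_backward_error_set_def
      by (intro min_of_perturbation_set[where X = X] matrix_seminorm_spectral w d lower X(1,2)
          symmetric_matrix_add symmetric_matrix_scaleR disjI1 refl)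
  qed
  moreover have "sym_backward_error frobenius_norm m f A w lam v = ereal (?d * \<gamma>) / ereal ?s"
  proof -
    obtain X where X: "symmetric_matrix X" "X *v v = - (A v *v v - lam *\<^sub>R v)"
      and X_sq: "(frobenius_norm X)\<^sup>2 = 2 * (- r \<bullet> - r) / (v \<bullet> v) - (v \<bullet> - r)\<^sup>2 / (v \<bullet> v)\<^sup>2"
      and min: "\<And>Y. symmetric_matrix Y \<Longrightarrow> Y *v v = - (A v *v v - lam *\<^sub>R v) \<Longrightarrow>
        frobenius_norm X \<le> frobenius_norm Y"
      using symmetric_frobenius_minimal_matrix[OF v, where y = "- r"] unfolding assms(7) by blast
    \<comment> \<open>The cosine of \<open>\<theta>\<close>. For \<open>r = 0\<close> it is 0 by the
      division convention, and \<open>?d = 0\<close> makes the value of \<open>\<gamma>\<close>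
      immaterial.\<close>
    let ?c = "(r \<bullet> v) / (norm r * norm v)"
    have "\<bar>?c\<bar> \<le> 1"
        using Cauchy_Schwarz_ineq2[of r v]
      by (auto simp: abs_mult divide_le_eq_1 zero_less_mult_iff)
    then have "(sin \<theta>)\<^sup>2 = 1 - ?c\<^sup>2"
      using assms(8) by (simp add: sin_squared_eq cos_arccos_abs)
    moreover have "?c\<^sup>2 \<le> 1"
      using \<open>\<bar>?c\<bar> \<le> 1\<close> by (simp add: abs_square_le_1)
    ultimately have \<gamma>_sq: "\<gamma>\<^sup>2 = 2 - ?c\<^sup>2" and \<gamma>: "\<gamma> \<ge> 1"
      using assms(9) by auto
    have "(frobenius_norm X)\<^sup>2 = (?d * \<gamma>)\<^sup>2"
    proof (cases "r = 0")
      case False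
      have "v \<bullet> v = (norm v)\<^sup>2" "- r \<bullet> - r = (norm r)\<^sup>2" "v \<bullet> - r = - (r \<bullet> v)"
        by (simp_all add: power2_norm_eq_inner inner_commute)
      then show ?thesis
        using False v unfolding X_sq power_mult_distrib \<gamma>_sq
        by (simp add: field_simps power2_eq_square)
    qed (simp add: X_sq)
    then have X_norm: "frobenius_norm X = ?d * \<gamma>"
      using \<gamma> by (simp add: frobenius_norm_eq_norm power2_eq_iff_nonneg)
    have "?d * \<gamma> \<ge> 0" "?d * \<gamma> = 0 \<Longrightarrow> A v *v v = lam *\<^sub>R v"
      using \<gamma> d by auto
    then show ?thesis
      unfolding sym_backward_error_def sym_backward_error_set_def
      by (intro min_of_perturbation_set[where X = X] matrix_seminorm_frobenius w X
          symmetric_matrix_add symmetric_matrix_scaleR)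
        (use min X_norm in auto)
  qed
  \<comment> \<open>Division in \<open>ereal\<close> is multiplication by the inverse, so
    \<open>\<gamma>\<close> can be moved out even when \<open>?s = 0\<close>.\<close>
  moreover have "ereal (?d * \<gamma>) / ereal ?s = ereal ?d / ereal ?s * ereal \<gamma>"
    by (simp only: divide_ereal_def times_ereal.simps(1)[symmetric] mult.assoc
        mult.commute[of "ereal \<gamma>"])
  ultimately show ?thesis using unstructured by simp
qed

end
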